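(* Let $M=(S,T,I,L,F=\{F_0,\ldots,F_f\})$ be a fair Kripke structure. Then there exist $k$ and $0<l\le k$ such that $M$ has an initialised fair $(k,l)$-loop if and only if there exists $k\in\mathbb{N}$ such that the general Büchi encoding $[\![M,k]\!]$ is satisfiable.
   Context: A fair Kripke structure $M=(S,T,I,L,F)$ has a finite state set $S$ (valuations of finitely many Boolean state variables), total transition relation $T\subseteq S\times S$, initial states $I\subseteq S$, labelling $L$, and acceptance sets $F_0,\dots,F_f\subseteq S$. An infinite path $s_0s_1\ldots$ is initialised if $s_0\in I$, and fair if it contains infinitely many states from each $F_m$. It is a $(k,l)$-loop if it equals $(s_0\ldots s_{l-1})(s_l\ldots s_k)^\omega$ with $0<l\le k$ and $s_{l-1}=s_k$. The general Büchi encoding for bound $k$: take propositional copies $s_0,\dots,s_k$ of the state variables and fresh Boolean variables $l_0..l_k$, $\mathit{InLoop}_0..\mathit{InLoop}_k$, $\mathit{LoopExists}$, and $\langle\!\langle Acc_m\rangle\!\rangle_i$ for $0\le m\le f$, $0\le i\le k$; $[\![M,k]\!]$ is the conjunction of: $I(s_0)\wedge\bigwedge_{i=1}^kT(s_{i-1},s_i)$; $l_0\Leftrightarrow\bot$, $\mathit{InLoop}_0\Leftrightarrow\bot$, and for $1\le i\le k$: $l_i\Rightarrow(s_{i-1}=s_k)$, $\mathit{InLoop}_i\Leftrightarrow\mathit{InLoop}_{i-1}\vee l_i$, $\mathit{InLoop}_{i-1}\Rightarrow\neg l_i$; $\mathit{LoopExists}\Leftrightarrow\mathit{InLoop}_k$;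 $\mathit{LoopExists}\Leftrightarrow\top$; and for each $0\le m\le f$: $\mathit{LoopExists}\Rightarrow\langle\!\langle Acc_m\rangle\!\rangle_k$, $\langle\!\langle Acc_m\rangle\!\rangle_0\Leftrightarrow\bot$, and $\langle\!\langle Acc_m\rangle\!\rangle_i\Leftrightarrow\langle\!\langle Acc_m\rangle\!\rangle_{i-1}\vee(\mathit{InLoop}_i\wedge s_i\in F_m)$ for $1\le i\le k$. *)

theory Defs
  imports Main "HOL-Library.Omega_Words_Fun"
begin

section \<open>Propositional formulas\<close>

datatype (atoms: 'a) fm =
    Bot | Top | Atom 'a | Neg "'a fm"
  | And "'a fm" "'a fm" | Or "'a fm" "'a fm" | Imp "'a fm" "'a fm" | Iff "'a fm" "'a fm"

text \<open>An assignment is given by the set of atoms that it makes true.\<close>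

primrec sat :: "'a set \<Rightarrow> 'a fm \<Rightarrow> bool" where
  "sat A Bot = False"
| "sat A Top = True"
| "sat A (Atom a) = (a \<in> A)"
| "sat A (Neg p) = (\<not> sat A p)"
| "sat A (And p q) = (sat A p \<and> sat A q)"
| "sat A (Or p q) = (sat A p \<or> sat A q)"
| "sat A (Imp p q) = (sat A p \<longrightarrow> sat A q)"
| "sat A (Iff p q) = (sat A p \<longleftrightarrow> sat A q)"

definition satisfiable :: "'a fm \<Rightarrow> bool" where
  "satisfiable p \<longleftrightarrow> (\<exists>A. sat A p)"

text \<open>Conjunction of a family of formulas over a finite index set; the conjuncts are taken in an
  arbitrary order.\<close>

definition Conj :: "'i set \<Rightarrow> ('i \<Rightarrow> 'a fm) \<Rightarrow> 'a fm" where
  "Conj J f = foldr (\<lambda>i. And (f i)) (SOME js. set js = J \<and> distinct js) Top"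

lemma Conj_list:
  assumes "finite J"
  obtains js where "set js = J" "distinct js" "Conj J f = foldr (\<lambda>i. And (f i)) js Top"
proof -
  have "\<exists>js. set js = J \<and> distinct js"
    using finite_distinct_list[OF assms] by blast
  from someI_ex[OF this] show ?thesis
    by (intro that[of "SOME js. set js = J \<and> distinct js"]) (auto simp: Conj_def)
qed

lemma sat_Conj [simp]:
  assumes "finite J"
  shows "sat A (Conj J f) \<longleftrightarrow> (\<forall>i\<in>J. sat A (f i))"
proof -
  obtain js where js: "set js = J" "Conj J f = foldr (\<lambda>i. And (f i)) js Top"
    using Conj_list[OF assms] by metis
  have "sat A (foldr (\<lambda>i. And (f i)) js Top) \<longleftrightarrow> (\<forall>i\<in>set js. sat A (f i))"
    by (induction js) auto
  then show ?thesis using js by simp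
qed

lemma atoms_Conj [simp]:
  assumes "finite J"
  shows "atoms (Conj J f) = (\<Union>i\<in>J. atoms (f i))"
proof -
  obtain js where js: "set js = J" "Conj J f = foldr (\<lambda>i. And (f i)) js Top"
    using Conj_list[OF assms] by metis
  have "atoms (foldr (\<lambda>i. And (f i)) js Top) = (\<Union>i\<in>set js. atoms (f i))"
    by (induction js) auto
  then show ?thesis using js by simp
qed


section \<open>Fair Kripke structures\<close>

text \<open>A state is a valuation of the state variables, given by the set of variables that it makes
  true.  The acceptance sets are \<open>acc M 0, \<dots>, acc M (facc M)\<close>; the values of
  \<open>acc M\<close> at larger indices are irrelevant.\<close>

type_synonym 'v state = "'v set"

record ('v, 'p) kripke =
  vars   :: "'v set"
  states :: "'v state set"
  step   :: "('v state \<times> 'v state) set"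
  init   :: "'v state set"
  label  :: "'v state \<Rightarrow> 'p set"
  facc   :: nat
  acc    :: "nat \<Rightarrow> 'v state set"

definition fair_kripke :: "('v, 'p) kripke \<Rightarrow> bool" where
  "fair_kripke M \<longleftrightarrow>
     finite (vars M) \<and>
     states M \<subseteq> Pow (vars M) \<and>
     step M \<subseteq> states M \<times> states M \<and>
     (\<forall>s\<in>states M. \<exists>t\<in>states M. (s, t) \<in> step M) \<and>
     init M \<subseteq> states M \<and>
     (\<forall>m\<le>facc M. acc M m \<subseteq> states M)"

definition is_path :: "('v, 'p) kripke \<Rightarrow> 'v state word \<Rightarrow> bool" where
  "is_path M \<pi> \<longleftrightarrow> (\<forall>i. (\<pi> i, \<pi> (Suc i)) \<in> step M)"

definition initialised :: "('v, 'p) kripke \<Rightarrow> 'v state word \<Rightarrow> bool" where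
  "initialised M \<pi> \<longleftrightarrow> \<pi> 0 \<in> init M"

definition fair :: "('v, 'p) kripke \<Rightarrow> 'v state word \<Rightarrow> bool" where
  "fair M \<pi> \<longleftrightarrow> (\<forall>m\<le>facc M. \<exists>\<^sub>\<infinity>i. \<pi> i \<in> acc M m)"

text \<open>The finite word \<open>\<pi> [i \<rightarrow> j]\<close> excludes the letter \<open>\<pi> j\<close>.\<close>

definition is_loop :: "nat \<Rightarrow> nat \<Rightarrow> 'v state word \<Rightarrow> bool" where
  "is_loop k l \<pi> \<longleftrightarrow>
     0 < l \<and> l \<le> k \<and> \<pi> (l - 1) = \<pi> k \<and>
     \<pi> = (\<pi> [0 \<rightarrow> l]) \<frown> (\<pi> [l \<rightarrow> Suc k])\<^sup>\<omega>"


section \<open>Symbolic representation\<close>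

text \<open>The propositional formulas by which the initial states, the transition relation and the
  acceptance sets enter the encoding.  The transition formula speaks about the current
  (\<^const>\<open>Inl\<close>) and the next (\<^const>\<open>Inr\<close>) value of each state variable.\<close>

record 'v symbolic =
  init_fm  :: "'v fm"
  trans_fm :: "('v + 'v) fm"
  acc_fm   :: "nat \<Rightarrow> 'v fm"

definition represents :: "'v symbolic \<Rightarrow> ('v, 'p) kripke \<Rightarrow> bool" where
  "represents R M \<longleftrightarrow>
     atoms (init_fm R) \<subseteq> vars M \<and>
     (\<forall>s\<subseteq>vars M. sat s (init_fm R) \<longleftrightarrow> s \<in> init M) \<and>
     atoms (trans_fm R) \<subseteq> vars M <+> vars M \<and>
     (\<forall>s\<subseteq>vars M. \<forall>t\<subseteq>vars M. sat (s <+> t) (trans_fm R) \<longleftrightarrow> (s, t) \<in> step M) \<and>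
     (\<forall>m\<le>facc M. atoms (acc_fm R m) \<subseteq> vars M \<and>
        (\<forall>s\<subseteq>vars M. sat s (acc_fm R m) \<longleftrightarrow> s \<in> acc M m))"

text \<open>Every fair Kripke structure has a symbolic representation, so assuming one is no
  restriction.\<close>

lemma ex_formula:
  assumes V: "finite V"
  shows "\<exists>p. atoms p \<subseteq> V \<and> (\<forall>s\<subseteq>V. sat s p \<longleftrightarrow> s \<in> A)"
proof -
  define lit where "lit t v = (if v \<in> t then Atom v else Neg (Atom v))" for t and v :: 'a
  define p where "p = Neg (Conj (A \<inter> Pow V) (\<lambda>t. Neg (Conj V (lit t))))"
  have fin: "finite (A \<inter> Pow V)" using V by simp
  have lit: "sat s (lit t v) \<longleftrightarrow> (v \<in> s \<longleftrightarrow> v \<in> t)" for s t v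
    by (simp add: lit_def)
  have "sat s p \<longleftrightarrow> (\<exists>t\<in>A \<inter> Pow V. \<forall>v\<in>V. v \<in> s \<longleftrightarrow> v \<in> t)" for s
    using fin V by (simp add: p_def lit)
  moreover have "(\<exists>t\<in>A \<inter> Pow V. \<forall>v\<in>V. v \<in> s \<longleftrightarrow> v \<in> t) \<longleftrightarrow> s \<in> A" if "s \<subseteq> V" for s
  proof
    assume "\<exists>t\<in>A \<inter> Pow V. \<forall>v\<in>V. v \<in> s \<longleftrightarrow> v \<in> t"
    then obtain t where "t \<in> A" "t \<subseteq> V" "\<forall>v\<in>V. v \<in> s \<longleftrightarrow> v \<in> t" by auto
    with that have "s = t" by auto
    with \<open>t \<in> A\<close> show "s \<in> A" by simp
  next
    assume "s \<in> A"
    with that show "\<exists>t\<in>A \<inter> Pow V. \<forall>v\<in>V. v \<in> s \<longleftrightarrow> v \<in> t"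
      by (intro bexI[of _ s]) simp_all
  qed
  moreover have "atoms p \<subseteq> V"
    using fin V by (auto simp: p_def lit_def split: if_splits)
  ultimately show ?thesis by blast
qed

lemma ex_represents:
  assumes "fair_kripke M"
  shows "\<exists>R. represents R M"
proof -
  let ?V = "vars M"
  have V: "finite ?V" using assms by (simp add: fair_kripke_def)
  obtain p where p: "atoms p \<subseteq> ?V" "\<forall>s\<subseteq>?V. sat s p \<longleftrightarrow> s \<in> init M"
    using ex_formula[OF V, of "init M"] by blast
  have VV: "finite (?V <+> ?V)" using V by simp
  obtain q where q: "atoms q \<subseteq> ?V <+> ?V"
      "\<forall>u\<subseteq>?V <+> ?V. sat u q \<longleftrightarrow> u \<in> {s <+> t |s t. (s, t) \<in> step M}"
    using ex_formula[OF VV, of "{s <+> t |s t. (s, t) \<in> step M}"] by blast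
  have "\<exists>r. \<forall>m. atoms (r m) \<subseteq> ?V \<and> (\<forall>s\<subseteq>?V. sat s (r m) \<longleftrightarrow> s \<in> acc M m)"
    by (rule choice, rule allI, rule ex_formula[OF V])
  then obtain r where r: "\<forall>m. atoms (r m) \<subseteq> ?V \<and> (\<forall>s\<subseteq>?V. sat s (r m) \<longleftrightarrow> s \<in> acc M m)" ..
  have vim: "Inl -` (s <+> t) = s" "Inr -` (s <+> t) = t" for s t :: "'a set"
    by auto
  have inj: "s <+> t = s' <+> t' \<longleftrightarrow> s = s' \<and> t = t'" for s t s' t' :: "'a set"
    by (metis vim)
  have "sat (s <+> t) q \<longleftrightarrow> (s, t) \<in> step M" if "s \<subseteq> ?V" "t \<subseteq> ?V" for s t
  proof -
    have "s <+> t \<subseteq> ?V <+> ?V" using that by auto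
    then show ?thesis using q(2) by (auto simp: inj)
  qed
  then have "represents \<lparr>init_fm = p, trans_fm = q, acc_fm = r\<rparr> M"
    using p q(1) r by (simp add: represents_def)
  then show ?thesis ..
qed


section \<open>The general Buechi encoding\<close>

text \<open>\<open>StateVar i v\<close> is the copy of the state variable \<open>v\<close> in \<open>s\<^sub>i\<close>, \<open>LoopSel i\<close> is the
  loop selector \<open>l\<^sub>i\<close>, and \<open>Acc m i\<close> is the variable for the acceptance set \<open>F\<^sub>m\<close> at
  position \<open>i\<close>.\<close>

datatype 'v bvar =
  StateVar nat 'v | LoopSel nat | InLoop nat | LoopExists | Acc nat nat

definition init_at :: "'v symbolic \<Rightarrow> nat \<Rightarrow> 'v bvar fm" where
  "init_at R i = map_fm (StateVar i) (init_fm R)"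

definition trans_at :: "'v symbolic \<Rightarrow> nat \<Rightarrow> nat \<Rightarrow> 'v bvar fm" where
  "trans_at R i j = map_fm (case_sum (StateVar i) (StateVar j)) (trans_fm R)"

definition acc_at :: "'v symbolic \<Rightarrow> nat \<Rightarrow> nat \<Rightarrow> 'v bvar fm" where
  "acc_at R m i = map_fm (StateVar i) (acc_fm R m)"

definition state_eq :: "('v, 'p) kripke \<Rightarrow> nat \<Rightarrow> nat \<Rightarrow> 'v bvar fm" where
  "state_eq M i j = Conj (vars M) (\<lambda>v. Iff (Atom (StateVar i v)) (Atom (StateVar j v)))"

definition path_constraints :: "'v symbolic \<Rightarrow> nat \<Rightarrow> 'v bvar fm" where
  "path_constraints R k = And (init_at R 0) (Conj {1..k} (\<lambda>i. trans_at R (i - 1) i))"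

definition loop_constraints :: "('v, 'p) kripke \<Rightarrow> nat \<Rightarrow> 'v bvar fm" where
  "loop_constraints M k =
     And (Iff (Atom (LoopSel 0)) Bot)
    (And (Iff (Atom (InLoop 0)) Bot)
    (And (Conj {1..k} (\<lambda>i.
            And (Imp (Atom (LoopSel i)) (state_eq M (i - 1) k))
           (And (Iff (Atom (InLoop i)) (Or (Atom (InLoop (i - 1))) (Atom (LoopSel i))))
                (Imp (Atom (InLoop (i - 1))) (Neg (Atom (LoopSel i)))))))
         (Iff (Atom LoopExists) (Atom (InLoop k)))))"

definition acc_constraints :: "'v symbolic \<Rightarrow> nat \<Rightarrow> nat \<Rightarrow> 'v bvar fm" where
  "acc_constraints R k m =
     And (Imp (Atom LoopExists) (Atom (Acc m k)))
    (And (Iff (Atom (Acc m 0)) Bot)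
         (Conj {1..k} (\<lambda>i.
            Iff (Atom (Acc m i))
                (Or (Atom (Acc m (i - 1))) (And (Atom (InLoop i)) (acc_at R m i))))))"

definition buechi_encoding :: "('v, 'p) kripke \<Rightarrow> 'v symbolic \<Rightarrow> nat \<Rightarrow> 'v bvar fm" where
  "buechi_encoding M R k =
     And (path_constraints R k)
    (And (loop_constraints M k)
    (And (Iff (Atom LoopExists) Top)
         (Conj {0..facc M} (acc_constraints R k))))"

end

theory Submission
  imports Defs
begin

text \<open>Both sides hold for the same bounds \<open>k\<close>.  From a fair loop one reads off a model by putting
  \<open>l\<^sub>i\<close> true exactly at \<open>i = l\<close>.  Conversely, the least \<open>l\<close> with \<open>InLoop\<^sub>l\<close> true is a
  loop start: \<open>l\<^sub>l\<close> holds there, and \<open>Acc m\<close> can only become true at a position \<open>\<ge> l\<close>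
  that lies in \<open>F\<^sub>m\<close>.\<close>

lemma sat_map_fm: "sat A (map_fm f p) \<longleftrightarrow> sat (f -` A) p"
  by (induction p) auto

lemma sat_cong: "A \<inter> atoms p = B \<inter> atoms p \<Longrightarrow> sat A p \<longleftrightarrow> sat B p"
proof (induction p)
  case (Atom a)
  then show ?case by auto
next
  case (And p q)
  have "A \<inter> atoms p = B \<inter> atoms p" "A \<inter> atoms q = B \<inter> atoms q" using And.prems by auto
  then show ?case using And.IH by simp
next
  case (Or p q)
  have "A \<inter> atoms p = B \<inter> atoms p" "A \<inter> atoms q = B \<inter> atoms q" using Or.prems by auto
  then show ?case using Or.IH by simp
next
  case (Imp p q)
  have "A \<inter> atoms p = B \<inter> atoms p" "A \<inter> atoms q = B \<inter> atoms q" using Imp.prems by auto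
  then show ?case using Imp.IH by simp
next
  case (Iff p q)
  have "A \<inter> atoms p = B \<inter> atoms p" "A \<inter> atoms q = B \<inter> atoms q" using Iff.prems by auto
  then show ?case using Iff.IH by simp
qed auto

text \<open>The restriction to \<open>vars M\<close> matters: an assignment may make
  \<open>StateVar i v\<close> true for some \<open>v\<close> outside \<open>vars M\<close>, whereas
  \<open>represents\<close> speaks about subsets of \<open>vars M\<close> only.\<close>

definition state_at :: "('v, 'p) kripke \<Rightarrow> 'v bvar set \<Rightarrow> nat \<Rightarrow> 'v state" where
  "state_at M A i = {v \<in> vars M. StateVar i v \<in> A}"

lemma state_at_subset: "state_at M A i \<subseteq> vars M"
  by (auto simp: state_at_def)

lemma sat_map_StateVar:
  assumes "atoms p \<subseteq> vars M"
  shows "sat A (map_fm (StateVar i) p) \<longleftrightarrow> sat (state_at M A i) p"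
  unfolding sat_map_fm using assms by (intro sat_cong) (auto simp: state_at_def)

lemma sat_init_at:
  assumes "represents R M"
  shows "sat A (init_at R i) \<longleftrightarrow> state_at M A i \<in> init M"
  using assms state_at_subset[of M A i]
  by (simp add: represents_def init_at_def sat_map_StateVar[where M = M])

lemma sat_acc_at:
  assumes "represents R M" "m \<le> facc M"
  shows "sat A (acc_at R m i) \<longleftrightarrow> state_at M A i \<in> acc M m"
  using assms state_at_subset[of M A i]
  by (simp add: represents_def acc_at_def sat_map_StateVar[where M = M])

lemma sat_trans_at:
  assumes "represents R M"
  shows "sat A (trans_at R i j) \<longleftrightarrow> (state_at M A i, state_at M A j) \<in> step M"
proof -
  have "atoms (trans_fm R) \<subseteq> vars M <+> vars M"
    using assms by (simp add: represents_def)
  then have "sat A (trans_at R i j) \<longleftrightarrow> sat (state_at M A i <+> state_at M A j) (trans_fm R)"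
    unfolding trans_at_def sat_map_fm by (intro sat_cong) (auto simp: state_at_def)
  then show ?thesis
    using assms state_at_subset[of M A] by (simp add: represents_def)
qed

lemma sat_state_eq:
  assumes "finite (vars M)"
  shows "sat A (state_eq M i j) \<longleftrightarrow> state_at M A i = state_at M A j"
  using assms by (auto simp: state_eq_def state_at_def)

text \<open>Trades formulas for statements about the state sequence \<open>state_at M A\<close> and
  the index sets of the auxiliary variables; both directions start from this form. Since
  \<open>LoopExists\<close> is forced to be true, its implications collapse to
  \<open>InLoop k\<close> and \<open>Acc m k\<close>.\<close>

lemma sat_buechi_encoding:
  assumes "finite (vars M)" "represents R M"
  shows "sat A (buechi_encoding M R k) \<longleftrightarrow>
    state_at M A 0 \<in> init M \<and>
    (\<forall>i\<in>{1..k}. (state_at M A (i - 1), state_at M A i) \<in> step M) \<and>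
    LoopSel 0 \<notin> A \<and> InLoop 0 \<notin> A \<and>
    (\<forall>i\<in>{1..k}. (LoopSel i \<in> A \<longrightarrow> state_at M A (i - 1) = state_at M A k) \<and>
       (InLoop i \<in> A \<longleftrightarrow> InLoop (i - 1) \<in> A \<or> LoopSel i \<in> A) \<and>
       (InLoop (i - 1) \<in> A \<longrightarrow> LoopSel i \<notin> A)) \<and>
    InLoop k \<in> A \<and> LoopExists \<in> A \<and>
    (\<forall>m\<le>facc M. Acc m k \<in> A \<and> Acc m 0 \<notin> A \<and>
       (\<forall>i\<in>{1..k}. Acc m i \<in> A \<longleftrightarrow>
          Acc m (i - 1) \<in> A \<or> InLoop i \<in> A \<and> state_at M A i \<in> acc M m))"
proof -
  \<comment> \<open>This conjunct is treated separately because \<open>sat_acc_at\<close> is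
    conditional on \<open>m \<le> facc M\<close>; \<open>Ball_def\<close> turns that bound into a
    premise available to the simplifier.\<close>
  have *: "sat A (Conj {0..facc M} (acc_constraints R k)) \<longleftrightarrow>
    (\<forall>m\<le>facc M. (LoopExists \<in> A \<longrightarrow> Acc m k \<in> A) \<and> Acc m 0 \<notin> A \<and>
       (\<forall>i\<in>{1..k}. Acc m i \<in> A \<longleftrightarrow>
          Acc m (i - 1) \<in> A \<or> InLoop i \<in> A \<and> state_at M A i \<in> acc M m))"
    using assms(2) by (simp add: acc_constraints_def sat_acc_at Ball_def)
  show ?thesis
    unfolding buechi_encoding_def sat.simps *
    using assms
    by (auto simp: path_constraints_def loop_constraints_def sat_init_at sat_trans_at
        sat_state_eq)
qed

text \<open>Read pointwise, the word equation is trivial below \<open>l\<close>, so only periodicity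
  from \<open>l\<close> on remains. The repeated block includes both \<open>l\<close> and
  \<open>k\<close>, hence the period \<open>Suc k - l\<close>.\<close>

lemma is_loop_iff:
  "is_loop k l \<pi> \<longleftrightarrow>
     0 < l \<and> l \<le> k \<and> \<pi> (l - 1) = \<pi> k \<and> (\<forall>i\<ge>l. \<pi> i = \<pi> (l + (i - l) mod (Suc k - l)))"
proof -
  have "((\<pi> [0 \<rightarrow> l]) \<frown> (\<pi> [l \<rightarrow> Suc k])\<^sup>\<omega>) i =
      (if i < l then \<pi> i else \<pi> (l + (i - l) mod (Suc k - l)))" if "l \<le> k" for i
    using that mod_less_divisor[of "Suc k - l" "i - l"]
    by (simp add: conc_def iter_def subsequence_def nth_append del: upt_Suc mod_less_divisor)
  then show ?thesis
    unfolding is_loop_def fun_eq_iff by (metis not_le)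
qed

lemma mod_period_in_loop: "l \<le> k \<Longrightarrow> l + (i - l) mod (Suc k - l) \<in> {l..k}" for i k l :: nat
  using mod_less_divisor[of "Suc k - l" "i - l"] unfolding atLeastAtMost_iff by linarith

text \<open>From \<open>l\<close> on, every state already occurs in the window from \<open>l\<close>
  to \<open>k\<close>, and every state of that window recurs once per period.\<close>

lemma fair_loop_iff:
  assumes "is_loop k l \<pi>"
  shows "fair M \<pi> \<longleftrightarrow> (\<forall>m\<le>facc M. \<exists>j\<in>{l..k}. \<pi> j \<in> acc M m)"
proof -
  let ?p = "Suc k - l"
  have l: "l \<le> k" and per: "\<And>i. l \<le> i \<Longrightarrow> \<pi> i = \<pi> (l + (i - l) mod ?p)"
    using assms unfolding is_loop_iff by blast+
  have "(\<exists>\<^sub>\<infinity>i. \<pi> i \<in> X) \<longleftrightarrow> (\<exists>j\<in>{l..k}. \<pi> j \<in> X)" for X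
  proof
    assume "\<exists>\<^sub>\<infinity>i. \<pi> i \<in> X"
    then obtain i where "l \<le> i" "\<pi> i \<in> X" by (auto simp: INFM_nat_le)
    then show "\<exists>j\<in>{l..k}. \<pi> j \<in> X" using per mod_period_in_loop[OF l] by metis
  next
    assume "\<exists>j\<in>{l..k}. \<pi> j \<in> X"
    then obtain j where j: "l \<le> j" "\<pi> j \<in> X" by auto
    have "\<pi> (j + n * ?p) = \<pi> j" for n
    proof -
      have "j + n * ?p - l = j - l + n * ?p" using j(1) by linarith
      then have "(j + n * ?p - l) mod ?p = (j - l) mod ?p" by (simp only: mod_mult_self1)
      then show ?thesis using per[of j] per[of "j + n * ?p"] j(1) trans_le_add1 by metis
    qed
    \<comment> \<open>The period is at least 1, so the \<open>n\<close>-th recurrence of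
      \<open>j\<close> lies at or beyond any given bound \<open>n\<close>.\<close>
    moreover have "n \<le> j + n * ?p" for n
      using mult_le_mono2[of 1 ?p n] l by linarith
    ultimately show "\<exists>\<^sub>\<infinity>i. \<pi> i \<in> X"
      using j(2) unfolding INFM_nat_le by metis
  qed
  then show ?thesis by (simp add: fair_def)
qed

lemma satisfiable_if_loop:
  assumes "fair_kripke M" "represents R M"
    and \<pi>: "is_path M \<pi>" "initialised M \<pi>" "fair M \<pi>" "is_loop k l \<pi>"
  shows "satisfiable (buechi_encoding M R k)"
proof -
  have fin: "finite (vars M)" and sub: "\<pi> i \<subseteq> vars M" for i
    using assms(1) \<pi>(1) unfolding fair_kripke_def is_path_def by blast+
  have l: "0 < l" "l \<le> k" "\<pi> (l - 1) = \<pi> k"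
    using \<pi>(4) unfolding is_loop_iff by blast+
  \<comment> \<open>Once \<open>l\<close> is selected, the recurrences of the encoding dictate the
    other values: \<open>InLoop\<close> switches on at \<open>l\<close>, and \<open>Acc m i\<close>
    records a visit between \<open>l\<close> and \<open>i\<close>. For \<open>i < l\<close> that
    interval is empty, which makes \<open>Acc m 0\<close> false.\<close>
  define A where "A = {StateVar i v |i v. v \<in> \<pi> i} \<union> {LoopSel l, LoopExists} \<union> InLoop ` {l..}
    \<union> {Acc m i |m i. \<exists>j\<in>{l..i}. \<pi> j \<in> acc M m}"
  have mem: "LoopSel i \<in> A \<longleftrightarrow> i = l" "InLoop i \<in> A \<longleftrightarrow> l \<le> i" "LoopExists \<in> A"
    "Acc m i \<in> A \<longleftrightarrow> (\<exists>j\<in>{l..i}. \<pi> j \<in> acc M m)" for i m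
    by (auto simp: A_def)
  have st: "state_at M A i = \<pi> i" for i
    using sub by (auto simp: state_at_def A_def)
  have step: "(\<pi> (i - 1), \<pi> i) \<in> step M" if "i \<in> {1..k}" for i
    using \<pi>(1) that unfolding is_path_def by (cases i) auto
  \<comment> \<open>Splitting off the last index of the interval yields the recurrence for
    \<open>Acc\<close>, with \<open>l \<le> i\<close> in the role of
    \<open>InLoop i\<close>.\<close>
  have acc: "(\<exists>j\<in>{l..i}. \<pi> j \<in> X) \<longleftrightarrow> (\<exists>j\<in>{l..i - 1}. \<pi> j \<in> X) \<or> l \<le> i \<and> \<pi> i \<in> X"
    if "i \<in> {1..k}" for i X
    using that by (cases i) (auto simp: le_Suc_eq)
  have "sat A (buechi_encoding M R k)"
    unfolding sat_buechi_encoding[OF fin assms(2)] mem st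
    using l \<pi>(2,3) step acc mem(3) by (auto simp: fair_loop_iff[OF \<pi>(4)] initialised_def)
  then show ?thesis by (auto simp: satisfiable_def)
qed

text \<open>The finite sequence is unrolled by repeating positions \<open>l\<close> to
  \<open>k\<close>. The jump from \<open>k\<close> back to \<open>l\<close> is a transition because
  \<open>s k = s (l - 1)\<close> and \<open>s (l - 1)\<close> steps to \<open>s l\<close>.\<close>

lemma loop_if_lasso:
  assumes l: "0 < l" "l \<le> k" "s (l - 1) = s k"
    and step: "\<And>i. i < k \<Longrightarrow> (s i, s (Suc i)) \<in> step M"
    and acc: "\<And>m. m \<le> facc M \<Longrightarrow> \<exists>j\<in>{l..k}. s j \<in> acc M m"
  obtains \<pi> where "is_path M \<pi>" "\<pi> 0 = s 0" "fair M \<pi>" "is_loop k l \<pi>"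
proof
  let ?p = "Suc k - l"
  define \<pi> where "\<pi> i = s (if i < l then i else l + (i - l) mod ?p)" for i
  have \<pi>_prefix: "\<pi> i = s i" if "i \<le> k" for i
    using that by (simp add: \<pi>_def)
  show loop: "is_loop k l \<pi>"
    unfolding is_loop_iff using l \<pi>_prefix by (auto simp: \<pi>_def)
  show "\<pi> 0 = s 0" using l(1) by (simp add: \<pi>_def)
  show "fair M \<pi>"
    unfolding fair_loop_iff[OF loop] using acc \<pi>_prefix by fastforce
  have "(\<pi> i, \<pi> (Suc i)) \<in> step M" for i
  proof (cases "i < l")
    case True
    then show ?thesis using l step[of i] \<pi>_prefix by simp
  next
    case False
    define r where "r = (i - l) mod ?p"
    have r: "r < ?p" using l by (simp add: r_def)
    have i: "\<pi> i = s (l + r)" using False by (simp add: \<pi>_def r_def)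
    \<comment> \<open>The residue advances by one or, at the end of the block, wraps around to
      \<open>l\<close>.\<close>
    have Suc_i: "\<pi> (Suc i) = s (l + (if Suc r = ?p then 0 else Suc r))"
    proof -
      have "Suc i - l = Suc (i - l)" using False by linarith
      then show ?thesis using False by (simp only: \<pi>_def r_def mod_Suc not_less) simp
    qed
    show ?thesis
    proof (cases "Suc r = ?p")
      case True
      then have "l + r = k" using l by simp
      with i have "\<pi> i = s (l - 1)" using l by simp
      with True Suc_i show ?thesis using step[of "l - 1"] l by simp
    next
      case False
      with i Suc_i r show ?thesis using step[of "l + r"] by simp
    qed
  qed
  then show "is_path M \<pi>" by (simp add: is_path_def)
qed

lemma loop_if_satisfiable:
  assumes "fair_kripke M" "represents R M" "satisfiable (buechi_encoding M R k)"
  shows "\<exists>l \<pi>. is_path M \<pi> \<and> initialised M \<pi> \<and> fair M \<pi> \<and> is_loop k l \<pi>"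
proof -
  have fin: "finite (vars M)" using assms(1) by (simp add: fair_kripke_def)
  obtain A where A: "sat A (buechi_encoding M R k)"
    using assms(3) by (auto simp: satisfiable_def)
  note enc = A[unfolded sat_buechi_encoding[OF fin assms(2)]]
  let ?s = "state_at M A"
  define l where "l = (LEAST i. InLoop i \<in> A)"
  \<comment> \<open>The least index exists because the encoding forces
    \<open>InLoop k\<close>.\<close>
  have inl: "InLoop l \<in> A" and lk: "l \<le> k" and least: "\<And>i. InLoop i \<in> A \<Longrightarrow> l \<le> i"
    unfolding l_def using enc by (auto intro: LeastI Least_le)
  have l0: "0 < l" using enc inl by (metis gr0I)
  \<comment> \<open>With \<open>InLoop\<close> still false at \<open>l - 1\<close>, its recurrence
    at \<open>l\<close> can only be satisfied through \<open>LoopSel l\<close>.\<close>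
  have "InLoop (l - 1) \<notin> A" using least[of "l - 1"] l0 by auto
  then have "LoopSel l \<in> A" using enc inl l0 lk by auto
  then have eq: "?s (l - 1) = ?s k" using enc l0 lk by auto
  have "(?s i, ?s (Suc i)) \<in> step M" if "i < k" for i
  proof -
    have "Suc i \<in> {1..k}" using that by simp
    moreover have "\<forall>i\<in>{1..k}. (?s (i - 1), ?s i) \<in> step M" using enc by blast
    ultimately show ?thesis by fastforce
  qed
  moreover have "\<exists>j\<in>{l..k}. ?s j \<in> acc M m" if m: "m \<le> facc M" for m
  proof -
    \<comment> \<open>As \<open>Acc m\<close> starts false, tracing it back from \<open>i\<close>
      must reach a position \<open>j\<close> that switched it on.\<close>
    have "\<exists>j\<le>i. InLoop j \<in> A \<and> ?s j \<in> acc M m" if "Acc m i \<in> A" "i \<le> k" for i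
      using that
    proof (induction i)
      case 0
      then show ?case using enc m by blast
    next
      case (Suc i)
      have "Suc i \<in> {1..k}" using Suc.prems(2) by simp
      then have "Acc m (Suc i - 1) \<in> A \<or> InLoop (Suc i) \<in> A \<and> ?s (Suc i) \<in> acc M m"
        using enc m Suc.prems(1) by blast
      then show ?case using Suc by (auto intro: le_SucI)
    qed
    \<comment> \<open>The traced position for \<open>i = k\<close> lies in the window, since
      \<open>least\<close> turns \<open>InLoop j\<close> into \<open>l \<le> j\<close>.\<close>
    moreover have "Acc m k \<in> A" using enc m by blast
    ultimately show ?thesis using least by (meson atLeastAtMost_iff order_refl)
  qed
  ultimately obtain \<pi> where "is_path M \<pi>" "\<pi> 0 = ?s 0" "fair M \<pi>" "is_loop k l \<pi>"
    using loop_if_lasso[where s = ?s and M = M, OF l0 lk eq] by metis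
  moreover have "?s 0 \<in> init M" using enc by blast
  ultimately show ?thesis unfolding initialised_def by metis
qed

theorem theorem3p4:
  fixes M :: "('v, 'p) kripke" and R :: "'v symbolic"
  assumes "fair_kripke M" and "represents R M"
  shows "(\<exists>k l. 0 < l \<and> l \<le> k \<and>
            (\<exists>\<pi>. is_path M \<pi> \<and> initialised M \<pi> \<and> fair M \<pi> \<and> is_loop k l \<pi>))
     \<longleftrightarrow> (\<exists>k. satisfiable (buechi_encoding M R k))"
proof
  assume "\<exists>k l. 0 < l \<and> l \<le> k \<and>
            (\<exists>\<pi>. is_path M \<pi> \<and> initialised M \<pi> \<and> fair M \<pi> \<and> is_loop k l \<pi>)"
  then show "\<exists>k. satisfiable (buechi_encoding M R k)"
    using satisfiable_if_loop[OF assms] by blast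
next
  assume "\<exists>k. satisfiable (buechi_encoding M R k)"
  then obtain k l \<pi> where
    \<pi>: "is_path M \<pi>" "initialised M \<pi>" "fair M \<pi>" "is_loop k l \<pi>"
    using loop_if_satisfiable[OF assms] by blast
  moreover from \<pi>(4) have "0 < l" "l \<le> k" by (simp_all add: is_loop_def)
  ultimately show "\<exists>k l. 0 < l \<and> l \<le> k \<and>
            (\<exists>\<pi>. is_path M \<pi> \<and> initialised M \<pi> \<and> fair M \<pi> \<and> is_loop k l \<pi>)"
    by blast
qed

end
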